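(* Let $n\ge 3$, let $K\subset\mathbb{R}^n$ be a convex body and let $\Pi\subset\mathbb{R}^n$ be a hyperplane. Suppose that for every $x\in\Pi\setminus K$ the cone $C_x$ circumscribed to $K$ with apex $x$ is a right circular cone. Then $K$ is a ball.
   Context: A convex body in $\mathbb{R}^n$ is a compact convex set with non-empty interior; hyperplanes are affine. For $x\in\mathbb{R}^n\setminus K$, the solid cone generated by $K$ and $x$ is $\{x+\lambda(y-x) : y\in K,\ \lambda\ge 0\}$, and the cone $C_x$ circumscribed to $K$ with apex $x$ is the boundary of this solid cone. A convex cone $C$ with apex $x$ is a symmetric cone with axis $L_x$ if $L_x$ is a line through $x$ such that for every $2$-dimensional plane $\Gamma$ containing $L_x$, the line $L_x$ is the angle bisector of the angular region $\Gamma\cap C$. It is a right circular cone if, furthermore, for every hyperplane $H$ orthogonal to $L_x$ with $H\cap C\ne\emptyset$, the set $H\cap C$ is either a point or an $(n-1)$-dimensional ball. Saying that $C_x$ is a right circular cone means that the solid cone generated by $K$ and $x$ is a right circular cone. *)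

theory Defs
  imports "HOL-Analysis.Analysis"
begin

definition convex_body :: "'a::euclidean_space set \<Rightarrow> bool" where
  "convex_body K \<longleftrightarrow> compact K \<and> convex K \<and> interior K \<noteq> {}"

definition hyperplane :: "'a::euclidean_space set \<Rightarrow> bool" where
  "hyperplane H \<longleftrightarrow> affine H \<and> aff_dim H = int DIM('a) - 1"

definition solid_cone :: "'a::euclidean_space set \<Rightarrow> 'a \<Rightarrow> 'a set" where
  "solid_cone K x = {x + l *\<^sub>R (y - x) | l y. y \<in> K \<and> 0 \<le> l}"

definition vec_angle :: "'a::euclidean_space \<Rightarrow> 'a \<Rightarrow> real" where
  "vec_angle u v = arccos (u \<bullet> v / (norm u * norm v))"

definition angular_region :: "'a::euclidean_space \<Rightarrow> 'a \<Rightarrow> 'a \<Rightarrow> 'a set" where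
  "angular_region x u v = {x + s *\<^sub>R u + t *\<^sub>R v | s t. 0 \<le> s \<and> 0 \<le> t}"

(* The non-collinearity condition makes A a genuine angular region, with opening strictly
   between 0 and pi, so half-planes are excluded; the solid cone of a compact convex set from
   a point outside it is pointed, hence has no half-plane sections. Requiring x + w \<in> A selects
   the internal bisector. *)
definition angle_bisector :: "'a::euclidean_space set \<Rightarrow> 'a \<Rightarrow> 'a set \<Rightarrow> bool" where
  "angle_bisector L x A \<longleftrightarrow>
     (\<exists>u v w. \<not> collinear {0, u, v} \<and> A = angular_region x u v \<and>
        w \<noteq> 0 \<and> x + w \<in> A \<and> vec_angle u w = vec_angle w v \<and>
        L = range (\<lambda>t. x + t *\<^sub>R w))"

definition symmetric_cone :: "'a::euclidean_space set \<Rightarrow> 'a \<Rightarrow> 'a set \<Rightarrow> bool" where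
  "symmetric_cone C x L \<longleftrightarrow>
     convex C \<and> conic ((\<lambda>y. y - x) ` C) \<and>
     affine L \<and> aff_dim L = 1 \<and> x \<in> L \<and>
     (\<forall>\<Gamma>. affine \<Gamma> \<and> aff_dim \<Gamma> = 2 \<and> L \<subseteq> \<Gamma> \<longrightarrow> angle_bisector L x (\<Gamma> \<inter> C))"

definition orthogonal_flats :: "'a::euclidean_space set \<Rightarrow> 'a set \<Rightarrow> bool" where
  "orthogonal_flats H L \<longleftrightarrow>
     (\<forall>y\<in>H. \<forall>z\<in>H. \<forall>p\<in>L. \<forall>q\<in>L. orthogonal (y - z) (p - q))"

definition right_circular_cone :: "'a::euclidean_space set \<Rightarrow> 'a \<Rightarrow> bool" where
  "right_circular_cone C x \<longleftrightarrow>
     (\<exists>L. symmetric_cone C x L \<and>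
        (\<forall>H. hyperplane H \<and> orthogonal_flats H L \<and> H \<inter> C \<noteq> {} \<longrightarrow>
           (\<exists>c. H \<inter> C = {c}) \<or>
           (\<exists>c\<in>H. \<exists>r>0. H \<inter> C = H \<inter> cball c r)))"

(* The circumscribed cone with apex x is the boundary of the solid cone; it is called right
   circular when the solid cone it bounds is a right circular cone. *)
definition circumscribed_right_circular :: "'a::euclidean_space set \<Rightarrow> 'a \<Rightarrow> bool" where
  "circumscribed_right_circular K x \<longleftrightarrow> right_circular_cone (solid_cone K x) x"

end

theory Submission
  imports Defs
begin

text \<open>
  Let \<open>h\<close> be the support function of \<open>K\<close>. A ball inscribed in a right circular cone shows
  that for every \<open>x \<in> P - K\<close> there are \<open>y \<in> K\<close> and \<open>\<sigma>\<close> with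
  \<open>h v = v \<bullet> y + \<sigma> * norm v\<close> for all normals \<open>v\<close> of the supporting
  hyperplanes through \<open>x\<close>. As \<open>x\<close> goes to infinity in a direction \<open>w\<close> of
  \<open>P\<close>, these normals approach every vector orthogonal to \<open>w\<close>, so on the complement of
  \<open>w\<close> the function \<open>h\<close> is a limit of functions \<open>u \<bullet> y + \<sigma> * norm
  u\<close>: the projection of \<open>K\<close> along \<open>w\<close> is a ball. Let \<open>e\<close> be the unit
  normal of \<open>P\<close>. In dimension at least three every \<open>u\<close> shares such a complement with
  \<open>e\<close>; hence \<open>K\<close> has constant width \<open>2 * r\<close> and the odd part \<open>G\<close>
  of \<open>h\<close> is affine in direction \<open>e\<close>, that is, \<open>h (u + s *\<^sub>R e) = r * norm (u + s
  *\<^sub>R e) + G u + s * G e\<close>. Letting \<open>s\<close> tend to infinity in the subadditivity of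
  \<open>h\<close> makes \<open>G\<close> subadditive, and an odd sublinear function is linear.
\<close>

section \<open>Angle bisectors and the equation of a right circular cone\<close>

lemma angular_region_scale:
  assumes "a > 0" "b > 0"
  shows "angular_region x (a *\<^sub>R u) (b *\<^sub>R v) = angular_region x u v"
proof -
  have "angular_region x (a *\<^sub>R u) (b *\<^sub>R v) \<subseteq> angular_region x u v"
    if "a > 0" "b > 0" for a b :: real and u v :: 'a
  proof
    fix z assume "z \<in> angular_region x (a *\<^sub>R u) (b *\<^sub>R v)"
    then obtain s t where "z = x + s *\<^sub>R (a *\<^sub>R u) + t *\<^sub>R (b *\<^sub>R v)" "0 \<le> s" "0 \<le> t"
      unfolding angular_region_def by blast
    then have "z = x + (s * a) *\<^sub>R u + (t * b) *\<^sub>R v" "0 \<le> s * a" "0 \<le> t * b"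
      using that by auto
    then show "z \<in> angular_region x u v" unfolding angular_region_def by blast
  qed
  from this[OF assms, of u v] this[of "inverse a" "inverse b" "a *\<^sub>R u" "b *\<^sub>R v"] assms
  show ?thesis by auto
qed

text \<open>Once the generators are scaled to unit vectors, equal angles for
  \<open>w = s *\<^sub>R p + t *\<^sub>R q\<close> mean
  \<open>p \<bullet> w = q \<bullet> w\<close>, that is
  \<open>(s - t) * (1 - p \<bullet> q) = 0\<close>. Non-collinearity is strictness in
  Cauchy-Schwarz, so \<open>p \<bullet> q < 1\<close> and \<open>s = t\<close>.\<close>

lemma angle_bisector_unit_vectors:
  fixes x :: "'a::euclidean_space"
  assumes "angle_bisector L x A"
  obtains p q s where "norm p = 1" "norm q = 1" "p \<bullet> q < 1" "-1 < p \<bullet> q" "s > 0"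
    "A = angular_region x p q" "L = range (\<lambda>t. x + t *\<^sub>R (s *\<^sub>R (p + q)))"
proof -
  obtain u v w where nc: "\<not> collinear {0, u, v}" and A: "A = angular_region x u v"
    and w0: "w \<noteq> 0" and wA: "x + w \<in> A" and ang: "vec_angle u w = vec_angle w v"
    and L: "L = range (\<lambda>t. x + t *\<^sub>R w)"
    using assms unfolding angle_bisector_def by auto
  have u0: "u \<noteq> 0" and v0: "v \<noteq> 0" using nc by (auto simp: insert_commute)
  define p q where "p = sgn u" and "q = sgn v"
  have np: "norm p = 1" "norm q = 1" using u0 v0 by (auto simp: p_def q_def norm_sgn)
  have up: "u = norm u *\<^sub>R p" "v = norm v *\<^sub>R q" using u0 v0 by (auto simp: p_def q_def sgn_div_norm)
  have A': "A = angular_region x p q"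
    using angular_region_scale[of "norm u" "norm v" x p q] u0 v0 up A by simp
  have ab: "\<bar>p \<bullet> q\<bar> \<noteq> norm p * norm q"
  proof
    assume "\<bar>p \<bullet> q\<bar> = norm p * norm q"
    then have "\<bar>u \<bullet> v\<bar> = norm u * norm v"
      using np up by (metis (no_types, opaque_lifting) abs_mult abs_norm_cancel inner_scaleR_left inner_scaleR_right mult.left_commute mult.right_neutral)
    with nc show False by (simp add: norm_cauchy_schwarz_equal)
  qed
  have pq: "p \<bullet> q < 1" "-1 < p \<bullet> q"
    using Cauchy_Schwarz_ineq2[of p q] ab np by (auto simp: abs_if split: if_splits)
  obtain s t where st: "w = s *\<^sub>R p + t *\<^sub>R q" "s \<ge> 0" "t \<ge> 0"
    using wA unfolding A' angular_region_def by (auto simp: add.assoc)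
  \<comment> \<open>\<open>arccos\<close> is injective only on [-1, 1]. Cauchy-Schwarz puts both
    quotients there; for a zero vector the quotient is 0.\<close>
  have arc: "u \<bullet> w / (norm u * norm w) = w \<bullet> v / (norm w * norm v)"
  proof -
    have b: "\<bar>a \<bullet> b / (norm a * norm b)\<bar> \<le> 1" for a b :: 'a
      using Cauchy_Schwarz_ineq2[of a b] by (cases "a = 0 \<or> b = 0") (auto simp: divide_le_eq)
    show ?thesis using ang arccos_eq_iff[OF conjI[OF b b]] unfolding vec_angle_def by blast
  qed
  have "p \<bullet> w = q \<bullet> w"
    using arc u0 v0 w0 by (simp add: p_def q_def sgn_div_norm field_simps inner_commute)
  then have "s + t * (p \<bullet> q) = s * (p \<bullet> q) + t"
    using np by (simp add: st inner_add_right inner_commute dot_square_norm)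
  then have "(s - t) * (1 - p \<bullet> q) = 0" by (simp add: algebra_simps)
  with pq have "s = t" by simp
  with st w0 have "w = s *\<^sub>R (p + q)" "s > 0" by (auto simp: scaleR_add_right less_le)
  with that[OF np pq _ A'] L show thesis by blast
qed

text \<open>This is the reflection in the line spanned by \<open>a\<close> only if \<open>norm a = 1\<close>.\<close>

definition axial_reflection :: "'a::real_inner \<Rightarrow> 'a \<Rightarrow> 'a" where
  "axial_reflection a z = (2 * (z \<bullet> a)) *\<^sub>R a - z"

text \<open>The line fixes \<open>a\<close> only up to sign, so \<open>\<epsilon>\<close> selects
  the direction that points into the region. The reflection does not depend on this sign and swaps
  the two unit generators, hence preserves the region. The last conclusion later rules out one-point
  slices.\<close>

lemma angle_bisector_axis:
  fixes x a :: "'a::euclidean_space"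
  assumes "angle_bisector L x A" and L: "L = range (\<lambda>t. x + t *\<^sub>R a)" and a: "norm a = 1"
  obtains \<epsilon> where "\<bar>\<epsilon>\<bar> = 1" "x + \<epsilon> *\<^sub>R a \<in> A"
    "\<And>z. x + z \<in> A \<Longrightarrow> z = 0 \<or> z \<bullet> (\<epsilon> *\<^sub>R a) > 0"
    "\<And>z. x + z \<in> A \<Longrightarrow> x + axial_reflection a z \<in> A"
    "\<exists>z. x + z \<in> A \<and> z \<noteq> (z \<bullet> a) *\<^sub>R a"
proof -
  obtain p q s where pq: "norm p = 1" "norm q = 1" "p \<bullet> q < 1" "-1 < p \<bullet> q" "s > 0"
    and A: "A = angular_region x p q" and L': "L = range (\<lambda>t. x + t *\<^sub>R (s *\<^sub>R (p + q)))"
    using angle_bisector_unit_vectors[OF assms(1)] by metis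
  have sq: "p \<bullet> p = 1" "q \<bullet> q = 1" "q \<bullet> p = p \<bullet> q" using pq by (auto simp: dot_square_norm inner_commute)
  have "x + 1 *\<^sub>R (s *\<^sub>R (p + q)) \<in> range (\<lambda>t. x + t *\<^sub>R a)" using L L' by (metis rangeI)
  then have "\<exists>k. s *\<^sub>R (p + q) = k *\<^sub>R a" by auto
  then obtain k where k: "s *\<^sub>R (p + q) = k *\<^sub>R a" ..
  have pq0: "(p + q) \<bullet> (p + q) = 2 * (1 + p \<bullet> q)"
    by (simp add: inner_add_left inner_add_right sq)
  have "p + q \<noteq> 0" using pq0 pq by auto
  then have k0: "k \<noteq> 0" using k pq by auto
  \<comment> \<open>\<open>d\<close> is the length of \<open>p + q\<close>, and
    \<open>\<epsilon>\<close> tells whether \<open>a\<close> or \<open>- a\<close> points along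
    it.\<close>
  define \<epsilon> where "\<epsilon> = sgn k"
  define d where "d = \<bar>k\<bar> / s"
  have d: "d > 0" using k0 pq by (simp add: d_def)
  have e: "\<bar>\<epsilon>\<bar> = 1" using k0 by (simp add: \<epsilon>_def abs_sgn_eq)
  have "s *\<^sub>R (p + q) = s *\<^sub>R ((d * \<epsilon>) *\<^sub>R a)"
    unfolding k d_def \<epsilon>_def using pq(5) by (simp add: abs_mult_sgn)
  then have sum: "p + q = (d * \<epsilon>) *\<^sub>R a" using pq(5) by (metis less_irrefl real_vector.scale_left_imp_eq)
  have ee: "\<epsilon> * \<epsilon> = 1" using e by (metis abs_mult_self_eq mult_1)
  have ea: "\<epsilon> *\<^sub>R a = (1 / d) *\<^sub>R (p + q)" using d by (simp add: sum)
  have aa: "a \<bullet> a = 1" using a by (simp add: dot_square_norm)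
  have d2: "d * d = 2 * (1 + p \<bullet> q)"
    using pq0 ee unfolding sum by (simp add: aa) (metis (no_types, lifting) mult.assoc mult.commute mult.right_neutral)
  have a_eq: "a = (\<epsilon> / d) *\<^sub>R (p + q)"
    using d ee by (simp add: sum)
  \<comment> \<open>Both generators have inner product \<open>1 + p \<bullet> q\<close> with
    \<open>p + q\<close>, half of its squared length, so twice their projection to the axis is
    \<open>p + q\<close>.\<close>
  have refl: "axial_reflection a p = q" "axial_reflection a q = p"
  proof -
    have 1: "2 * (z \<bullet> a) * (\<epsilon> / d) = 1" if "z \<bullet> (p + q) = 1 + p \<bullet> q" for z
    proof -
      have "2 * (z \<bullet> a) * (\<epsilon> / d) = 2 * (\<epsilon> * \<epsilon>) * (1 + p \<bullet> q) / (d * d)"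
        unfolding a_eq inner_scaleR_right that by simp
      also have "\<dots> = 1" unfolding d2 ee using pq by simp
      finally show ?thesis .
    qed
    have "(2 * (z \<bullet> a)) *\<^sub>R a = p + q" if "z \<bullet> (p + q) = 1 + p \<bullet> q" for z
      using 1[OF that] a_eq by (metis scaleR_scaleR scaleR_one)
    then show "axial_reflection a p = q" "axial_reflection a q = p"
      unfolding axial_reflection_def by (auto simp: inner_add_right sq)
  qed
  have pos: "p \<bullet> (\<epsilon> *\<^sub>R a) > 0" "q \<bullet> (\<epsilon> *\<^sub>R a) > 0"
    unfolding ea using d pq by (simp_all add: inner_add_right sq)
  show thesis
  proof (rule that[OF e])
    have "x + (1 / d) *\<^sub>R p + (1 / d) *\<^sub>R q \<in> A" unfolding A angular_region_def using d by (intro CollectI exI[of _ "1 / d"]) auto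
    then show "x + \<epsilon> *\<^sub>R a \<in> A" unfolding ea by (simp add: scaleR_add_right add.assoc)
  next
    fix z assume "x + z \<in> A"
    then obtain b c where z: "z = b *\<^sub>R p + c *\<^sub>R q" "b \<ge> 0" "c \<ge> 0"
      unfolding A angular_region_def by (auto simp: add.assoc)
    have "z \<bullet> (\<epsilon> *\<^sub>R a) = b * (p \<bullet> (\<epsilon> *\<^sub>R a)) + c * (q \<bullet> (\<epsilon> *\<^sub>R a))"
      unfolding z by (simp only: inner_add_left inner_scaleR_left)
    then show "z = 0 \<or> z \<bullet> (\<epsilon> *\<^sub>R a) > 0"
      using z pos by (cases "b = 0"; cases "c = 0") (auto simp: add_pos_pos simp del: inner_scaleR_right)
    have "axial_reflection a z = b *\<^sub>R axial_reflection a p + c *\<^sub>R axial_reflection a q"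
      unfolding z axial_reflection_def by (simp add: algebra_simps inner_add_left)
    also have "\<dots> = c *\<^sub>R p + b *\<^sub>R q" using refl by simp
    finally show "x + axial_reflection a z \<in> A"
      unfolding A angular_region_def using z by (auto simp: add.assoc)
  next
    have "x + 1 *\<^sub>R p + 0 *\<^sub>R q \<in> A" unfolding A angular_region_def by (intro CollectI exI[of _ 1] exI[of _ 0]) auto
    moreover have "p \<noteq> (p \<bullet> a) *\<^sub>R a"
    proof
      assume *: "p = (p \<bullet> a) *\<^sub>R a"
      then have "(2 * (p \<bullet> a)) *\<^sub>R a = 2 *\<^sub>R p" by (metis scaleR_scaleR)
      then have "axial_reflection a p = p" unfolding axial_reflection_def by (simp add: scaleR_2)
      then have "p = q" using refl by simp
      with sq pq show False by simp
    qed
    ultimately show "\<exists>z. x + z \<in> A \<and> z \<noteq> (z \<bullet> a) *\<^sub>R a" by auto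
  qed
qed

text \<open>The symmetry of a cone is given plane by plane, so each point has to be placed in a
  plane through the axis. For a point on the axis any further direction completes the plane.\<close>

lemma plane_containing_axis:
  fixes x a z :: "'a::euclidean_space"
  assumes "norm a = 1" "DIM('a) \<ge> 2"
  obtains \<Gamma> where "affine \<Gamma>" "aff_dim \<Gamma> = 2" "range (\<lambda>t. x + t *\<^sub>R a) \<subseteq> \<Gamma>" "x + z \<in> \<Gamma>"
proof -
  obtain z' where z': "z' \<notin> span {a}" "z \<in> span {a, z'}"
  proof (cases "z \<in> span {a}")
    case True
    have "dim {a} < DIM('a)" using assms dim_singleton[of a] by (auto split: if_splits)
    then have "span {a} \<noteq> UNIV" using dim_eq_full by (metis less_irrefl)
    then obtain z' where "z' \<notin> span {a}" by auto
    moreover have "z \<in> span {a, z'}" using True span_mono[of "{a}" "{a, z'}"] by auto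
    ultimately show thesis using that by blast
  next
    case False
    then show thesis using that by (simp add: span_base)
  qed
  have na: "z' \<noteq> a" using z' span_base by blast
  have "independent {z', a}" using z' assms by (intro independent_insertI independent_empty) auto
  then have dim: "dim {a, z'} = 2" using na by (subst dim_eq_card_independent) (auto simp: insert_commute)
  show thesis
  proof (rule that)
    show "affine ((+) x ` span {a, z'})" using affine_translation subspace_imp_affine subspace_span by blast
    show "aff_dim ((+) x ` span {a, z'}) = 2" by (simp add: aff_dim_translation_eq aff_dim_subspace dim)
    show "range (\<lambda>t. x + t *\<^sub>R a) \<subseteq> (+) x ` span {a, z'}" by (auto simp: span_base span_mul)
    show "x + z \<in> (+) x ` span {a, z'}" using z' by auto
  qed
qed

lemma affine_line:
  fixes x :: "'a::euclidean_space"
  assumes "affine L" "aff_dim L = 1" "x \<in> L"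
  obtains a where "norm a = 1" "L = range (\<lambda>t. x + t *\<^sub>R a)"
proof -
  have "aff_dim L \<noteq> aff_dim {x}" using assms by simp
  then have "L \<noteq> {x}" by auto
  then obtain y where y: "y \<in> L" "y \<noteq> x" using assms(3) by auto
  have "affine hull {x, y} = L"
    using assms y by (intro affine_dim_equal) (auto simp: hull_minimal aff_dim_2)
  moreover define a where "a = sgn (y - x)"
  have a: "norm a = 1" "y = x + norm (y - x) *\<^sub>R a" using y by (auto simp: a_def norm_sgn sgn_div_norm)
  ultimately have "L = {x + t *\<^sub>R (y - x) | t. True}"
    using affine_hull_2_alt[of x y] by auto
  moreover have "range (\<lambda>t. x + t *\<^sub>R (y - x)) = range (\<lambda>t. x + t *\<^sub>R a)"
  proof (intro equalityI subsetI)
    fix p assume "p \<in> range (\<lambda>t. x + t *\<^sub>R (y - x))"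
    then obtain t where "p = x + t *\<^sub>R (y - x)" by auto
    then have "p = x + (t * norm (y - x)) *\<^sub>R a" using y by (simp add: a_def sgn_div_norm)
    then show "p \<in> range (\<lambda>t. x + t *\<^sub>R a)" by auto
  next
    fix p assume "p \<in> range (\<lambda>t. x + t *\<^sub>R a)"
    then obtain t where "p = x + t *\<^sub>R a" by auto
    then have "p = x + (t / norm (y - x)) *\<^sub>R (y - x)" using y by (simp add: a_def sgn_div_norm divide_inverse)
    then show "p \<in> range (\<lambda>t. x + t *\<^sub>R (y - x))" by auto
  qed
  ultimately show thesis using that[OF a(1)] by (auto simp: full_SetCompr_eq)
qed

text \<open>The slice at height 1 over the apex is a ball, the reflection in the axis forces its
  centre onto the axis, and scaling carries this slice to every positive height. The radius
  \<open>\<rho>\<close> is the tangent of half the opening angle.\<close>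

lemma right_circular_cone_iff_norm_le:
  fixes x :: "'a::euclidean_space"
  assumes "right_circular_cone C x" and dim: "DIM('a) \<ge> 2"
  obtains a \<rho> where "norm a = 1" "\<rho> > 0"
    "\<And>z. x + z \<in> C \<longleftrightarrow> norm (z - (z \<bullet> a) *\<^sub>R a) \<le> \<rho> * (z \<bullet> a)"
proof -
  obtain L where sym: "symmetric_cone C x L"
    and slice: "\<And>H. hyperplane H \<Longrightarrow> orthogonal_flats H L \<Longrightarrow> H \<inter> C \<noteq> {} \<Longrightarrow>
           (\<exists>c. H \<inter> C = {c}) \<or> (\<exists>c\<in>H. \<exists>r>0. H \<inter> C = H \<inter> cball c r)"
    using assms(1) unfolding right_circular_cone_def by auto
  have bis: "angle_bisector L x (\<Gamma> \<inter> C)" if "affine \<Gamma>" "aff_dim \<Gamma> = 2" "L \<subseteq> \<Gamma>" for \<Gamma>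
    using sym that unfolding symmetric_cone_def by blast
  have conic: "conic ((\<lambda>y. y - x) ` C)" using sym unfolding symmetric_cone_def by blast
  have scale: "x + c *\<^sub>R z \<in> C" if "x + z \<in> C" "c \<ge> 0" for c z
  proof -
    have "z \<in> (\<lambda>y. y - x) ` C" using that(1) by (auto intro!: image_eqI[of _ _ "x + z"])
    then have "c *\<^sub>R z \<in> (\<lambda>y. y - x) ` C" using conic that(2) unfolding conic_def by blast
    then show ?thesis by auto
  qed
  obtain a0 where a0: "norm a0 = 1" and L0: "L = range (\<lambda>t. x + t *\<^sub>R a0)"
    using sym affine_line unfolding symmetric_cone_def by metis
  \<comment> \<open>This auxiliary plane serves to orient the axis:
    \<open>a = \<epsilon>0 *\<^sub>R a0\<close> points into \<open>C\<close>.\<close>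
  obtain \<Gamma>0 where \<Gamma>0: "affine \<Gamma>0" "aff_dim \<Gamma>0 = 2" "L \<subseteq> \<Gamma>0"
    using plane_containing_axis[OF a0 dim] L0 by metis
  obtain \<epsilon>0 where e0: "\<bar>\<epsilon>0\<bar> = 1" "x + \<epsilon>0 *\<^sub>R a0 \<in> \<Gamma>0 \<inter> C"
    and pos0: "\<And>z. x + z \<in> \<Gamma>0 \<inter> C \<Longrightarrow> z = 0 \<or> z \<bullet> (\<epsilon>0 *\<^sub>R a0) > 0"
    and ndeg0: "\<exists>z. x + z \<in> \<Gamma>0 \<inter> C \<and> z \<noteq> (z \<bullet> a0) *\<^sub>R a0"
    using angle_bisector_axis[OF bis[OF \<Gamma>0] L0 a0] by metis
  define a where "a = \<epsilon>0 *\<^sub>R a0"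
  have na: "norm a = 1" using e0 a0 by (simp add: a_def)
  then have aa: "a \<bullet> a = 1" by (simp add: dot_square_norm)
  have ee: "\<epsilon>0 * \<epsilon>0 = 1" using e0 by (metis abs_mult_self_eq mult_1)
  have L: "L = range (\<lambda>t. x + t *\<^sub>R a)"
  proof -
    have "x + t *\<^sub>R a0 = x + (t * \<epsilon>0) *\<^sub>R a" "x + t *\<^sub>R a = x + (t * \<epsilon>0) *\<^sub>R a0" for t
      using ee by (simp_all add: a_def mult.assoc)
    then show ?thesis unfolding L0 by (metis (no_types, lifting) image_subsetI rangeI subset_antisym)
  qed
  have aC: "x + a \<in> C" using e0 by (simp add: a_def)
  obtain z1 where z1: "x + z1 \<in> C" "z1 \<noteq> (z1 \<bullet> a) *\<^sub>R a"
  proof -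
    have "(z \<bullet> a) *\<^sub>R a = (z \<bullet> a0) *\<^sub>R a0" for z
      using ee unfolding a_def by simp
    then show thesis using that ndeg0 by auto
  qed
  have axis: "(z = 0 \<or> z \<bullet> a > 0) \<and> x + axial_reflection a z \<in> C" if z: "x + z \<in> C" for z
  proof -
    obtain \<Gamma> where \<Gamma>: "affine \<Gamma>" "aff_dim \<Gamma> = 2" "L \<subseteq> \<Gamma>" "x + z \<in> \<Gamma>"
      using plane_containing_axis[OF na dim] L by metis
    obtain \<epsilon> where e: "\<bar>\<epsilon>\<bar> = 1" "x + \<epsilon> *\<^sub>R a \<in> \<Gamma> \<inter> C"
      and pos: "\<And>z. x + z \<in> \<Gamma> \<inter> C \<Longrightarrow> z = 0 \<or> z \<bullet> (\<epsilon> *\<^sub>R a) > 0"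
      and refl: "\<And>z. x + z \<in> \<Gamma> \<inter> C \<Longrightarrow> x + axial_reflection a z \<in> \<Gamma> \<inter> C"
      using angle_bisector_axis[OF bis[OF \<Gamma>(1-3)] L na] by metis
    \<comment> \<open>Each plane comes with its own sign. The axis also lies in the auxiliary plane,
      where only the direction \<open>a\<close> points into \<open>C\<close>, so
      \<open>\<epsilon> = 1\<close>.\<close>
    have "x + \<epsilon> *\<^sub>R a \<in> \<Gamma>0 \<inter> C" using e \<Gamma>0 L by auto
    from pos0[OF this] have "\<epsilon> *\<^sub>R a = 0 \<or> 0 < \<epsilon>" using aa by (simp flip: a_def)
    with e na have "\<epsilon> = 1" by (auto simp: abs_if split: if_splits)
    with pos[of z] refl[of z] z \<Gamma> show ?thesis by auto
  qed
  define H where "H = {y. a \<bullet> y = a \<bullet> x + 1}"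
  have H_iff: "x + z \<in> H \<longleftrightarrow> z \<bullet> a = 1" for z
    by (auto simp: H_def inner_add_right inner_commute)
  have hyp: "hyperplane H"
    unfolding hyperplane_def H_def using aff_dim_hyperplane[of a "a \<bullet> x + 1"] aa
    by (fastforce simp: affine_hyperplane)
  have orth: "orthogonal_flats H L"
    unfolding orthogonal_flats_def orthogonal_def L H_def
    by (auto simp: inner_diff_left inner_diff_right inner_add_right inner_commute)
  have aH: "x + a \<in> H" using aa H_iff by simp
  have z1': "z1 \<noteq> 0" using z1 by auto
  \<comment> \<open>Besides the axis point \<open>x + a\<close> the slice contains the multiple of
    \<open>z1\<close> at height 1, which is off the axis.\<close>
  have "\<not> (\<exists>c. H \<inter> C = {c})"
  proof
    assume "\<exists>c. H \<inter> C = {c}"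
    then have uni: "y = x + a" if "y \<in> H" "y \<in> C" for y using aH aC that by (metis IntI singletonD)
    have p: "z1 \<bullet> a > 0" using axis[OF z1(1)] z1' by auto
    have "x + (1 / (z1 \<bullet> a)) *\<^sub>R z1 = x + a" using p scale[OF z1(1)] by (intro uni) (auto simp: H_iff)
    then have "(z1 \<bullet> a) *\<^sub>R ((1 / (z1 \<bullet> a)) *\<^sub>R z1) = (z1 \<bullet> a) *\<^sub>R a" by simp
    with p z1 show False by simp
  qed
  then obtain c r where c: "c \<in> H" "r > 0" "H \<inter> C = H \<inter> cball c r"
    using slice[OF hyp orth] aH aC by blast
  define d where "d = c - (x + a)"
  have da: "d \<bullet> a = 0" using c(1) aa by (simp add: d_def H_def inner_diff_right inner_add_right inner_commute)
  have "d = 0"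
  proof (rule ccontr)
    assume d0: "d \<noteq> 0"
    \<comment> \<open>\<open>x + (a + k *\<^sub>R d)\<close> is the point of the ball farthest from
      the axis. Its mirror image lies at distance \<open>2 * norm d + r\<close> from
      \<open>c\<close>, outside the ball.\<close>
    define k where "k = 1 + r / norm d"
    have "x + (a + k *\<^sub>R d) \<in> H" using da aa by (simp only: H_iff) (simp add: inner_add_left)
    moreover have "x + (a + k *\<^sub>R d) - c = (r / norm d) *\<^sub>R d" by (simp add: k_def d_def algebra_simps)
    then have "dist c (x + (a + k *\<^sub>R d)) = r"
      using c(2) d0 by (subst dist_commute, simp only: dist_norm) simp
    ultimately have "x + (a + k *\<^sub>R d) \<in> H \<inter> cball c r" by simp
    then have "x + (a + k *\<^sub>R d) \<in> C" using c(3) by blast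
    then have "x + axial_reflection a (a + k *\<^sub>R d) \<in> C" using axis by blast
    moreover have "axial_reflection a (a + k *\<^sub>R d) = a - k *\<^sub>R d"
      unfolding axial_reflection_def using da aa
      by (simp add: inner_add_left scaleR_2)
    ultimately have "x + (a - k *\<^sub>R d) \<in> C" by simp
    moreover have "x + (a - k *\<^sub>R d) \<in> H" using da aa by (simp only: H_iff) (simp add: inner_diff_left)
    ultimately have "x + (a - k *\<^sub>R d) \<in> H \<inter> cball c r" using c(3) by blast
    then have "dist c (x + (a - k *\<^sub>R d)) \<le> r" by simp
    moreover have "c - (x + (a - k *\<^sub>R d)) = (1 + k) *\<^sub>R d"
      by (simp add: d_def scaleR_left_distrib algebra_simps)
    moreover have "k > 0" using c(2) by (simp add: k_def add_pos_nonneg)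
    ultimately have "(1 + k) * norm d \<le> r" by (simp only: dist_norm norm_scaleR)
    moreover have "(1 + k) * norm d = 2 * norm d + r" using d0 by (simp add: k_def distrib_right)
    ultimately show False using d0 by simp
  qed
  then have ball: "x + z \<in> C \<longleftrightarrow> norm (z - a) \<le> r" if "z \<bullet> a = 1" for z
  proof -
    have "dist c (x + z) = norm (z - a)"
      using \<open>d = 0\<close> by (simp add: d_def dist_norm norm_minus_commute)
    moreover have "x + z \<in> H" using that H_iff by simp
    ultimately show ?thesis using c(3) by (metis IntD2 IntI mem_cball)
  qed
  have main: "x + z \<in> C \<longleftrightarrow> norm (z - (z \<bullet> a) *\<^sub>R a) \<le> r * (z \<bullet> a)" if p: "z \<bullet> a > 0" for z
  proof -
    define t where "t = z \<bullet> a"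
    have t: "t > 0" using p t_def by simp
    have "x + z \<in> C \<longleftrightarrow> x + (1 / t) *\<^sub>R z \<in> C"
      using scale[of z "1 / t"] scale[of "(1 / t) *\<^sub>R z" t] t by auto
    also have "\<dots> \<longleftrightarrow> norm ((1 / t) *\<^sub>R z - a) \<le> r" using t by (intro ball) (simp add: t_def)
    also have "(1 / t) *\<^sub>R z - a = (1 / t) *\<^sub>R (z - t *\<^sub>R a)" using t by (simp add: scaleR_diff_right)
    also have "norm \<dots> \<le> r \<longleftrightarrow> norm (z - t *\<^sub>R a) \<le> r * t"
      using t by (simp only: norm_scaleR) (simp add: pos_divide_le_eq)
    finally show ?thesis by (simp add: t_def)
  qed
  have "x \<in> C" using scale[OF aC, of 0] by simp
  have "x + z \<in> C \<longleftrightarrow> norm (z - (z \<bullet> a) *\<^sub>R a) \<le> r * (z \<bullet> a)" for z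
  proof (cases "z \<bullet> a > 0")
    case True then show ?thesis by (rule main)
  next
    case False
    have "z = 0" if "norm (z - (z \<bullet> a) *\<^sub>R a) \<le> r * (z \<bullet> a)"
    proof -
      have "0 \<le> r * (z \<bullet> a)" using that norm_ge_zero order_trans by blast
      then have "z \<bullet> a = 0" using c(2) False by (simp add: zero_le_mult_iff)
      then show ?thesis using that by simp
    qed
    then show ?thesis using axis[of z] False \<open>x \<in> C\<close> by auto
  qed
  with that na c(2) show thesis by blast
qed

text \<open>Split \<open>v\<close> into its axial part and the part \<open>m\<close> orthogonal to
  \<open>a\<close>. Testing \<open>neg\<close> on the ray most favourable to \<open>v\<close> gives
  \<open>v \<bullet> a \<le> - \<rho> * norm m\<close>; Cauchy-Schwarz on the contact ray
  \<open>z0\<close> gives the reverse. The quotient in the conclusion is the sine of half the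
  opening angle.\<close>

lemma supporting_normal_of_circular_cone:
  fixes a v z0 :: "'a::euclidean_space"
  assumes a: "norm a = 1" and \<rho>: "\<rho> > 0"
    and neg: "\<And>z. norm (z - (z \<bullet> a) *\<^sub>R a) \<le> \<rho> * (z \<bullet> a) \<Longrightarrow> v \<bullet> z \<le> 0"
    and z0: "z0 \<noteq> 0" "norm (z0 - (z0 \<bullet> a) *\<^sub>R a) \<le> \<rho> * (z0 \<bullet> a)" "v \<bullet> z0 = 0"
  shows "v \<bullet> a = - (\<rho> / sqrt (1 + \<rho>\<^sup>2)) * norm v"
proof -
  have aa: "a \<bullet> a = 1" using a by (simp add: dot_square_norm)
  define m where "m = v - (v \<bullet> a) *\<^sub>R a"
  have ma: "m \<bullet> a = 0" "a \<bullet> m = 0" using aa by (simp_all add: m_def inner_diff_left inner_diff_right inner_commute)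
  have v: "v = (v \<bullet> a) *\<^sub>R a + m" by (simp add: m_def)
  have "v \<bullet> a \<le> - \<rho> * norm m"
  proof -
    \<comment> \<open>Among the points of the cone at height 1 this one maximises the inner product
      with \<open>v\<close>; for \<open>m = 0\<close> it is \<open>a\<close>, as
      \<open>sgn 0 = 0\<close>.\<close>
    define z where "z = a + \<rho> *\<^sub>R sgn m"
    have za: "z \<bullet> a = 1" using aa ma by (simp add: z_def inner_add_left sgn_div_norm)
    have "norm (sgn m) \<le> 1" by (simp add: norm_sgn)
    then have "v \<bullet> z \<le> 0" using neg[of z] za \<rho> by (simp add: z_def mult_left_le)
    moreover have "v \<bullet> sgn m = norm m"
    proof -
      have "v \<bullet> m = m \<bullet> m" using ma by (subst v) (simp add: inner_add_left)
      then show ?thesis by (cases "m = 0") (simp_all add: sgn_div_norm dot_square_norm power2_eq_square)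
    qed
    ultimately show ?thesis by (simp add: z_def inner_add_right)
  qed
  moreover have "v \<bullet> a \<ge> - \<rho> * norm m"
  proof -
    define t where "t = z0 \<bullet> a"
    define n where "n = z0 - t *\<^sub>R a"
    have na: "n \<bullet> a = 0" "a \<bullet> n = 0" using aa by (simp_all add: n_def t_def inner_diff_left inner_diff_right inner_commute)
    have nn: "norm n \<le> \<rho> * t" using z0 by (simp add: n_def t_def)
    have "0 \<le> \<rho> * t" using nn norm_ge_zero order_trans by blast
    then have "t \<ge> 0" using \<rho> by (simp add: zero_le_mult_iff)
    moreover have "t \<noteq> 0" using nn z0(1) by (auto simp: n_def)
    ultimately have t: "t > 0" by simp
    have "v \<bullet> z0 = v \<bullet> (t *\<^sub>R a + n)" by (simp add: n_def)
    also have "\<dots> = t * (v \<bullet> a) + v \<bullet> n" by (simp add: inner_add_right)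
    also have "v \<bullet> n = m \<bullet> n" using na by (subst v) (simp add: inner_add_left)
    finally have "t * (v \<bullet> a) = - (m \<bullet> n)" using z0 by simp
    moreover have "m \<bullet> n \<le> norm m * (\<rho> * t)"
      using norm_cauchy_schwarz[of m n] mult_left_mono[OF nn norm_ge_zero[of m]] by linarith
    ultimately have "t * (- \<rho> * norm m) \<le> t * (v \<bullet> a)" by (simp add: algebra_simps)
    then show ?thesis using t by (simp only: mult_le_cancel_left_pos)
  qed
  ultimately have eq: "v \<bullet> a = - \<rho> * norm m" by simp
  have "(norm v)\<^sup>2 = (v \<bullet> a)\<^sup>2 + (norm m)\<^sup>2"
    unfolding dot_square_norm[symmetric] using aa ma
    by (subst (1 2) v) (simp add: inner_add_left inner_add_right power2_eq_square)
  also have "\<dots> = (1 + \<rho>\<^sup>2) * (norm m)\<^sup>2" unfolding eq by (simp add: power_mult_distrib algebra_simps)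
  finally have "norm v = sqrt (1 + \<rho>\<^sup>2) * norm m"
    by (metis norm_ge_zero real_sqrt_abs real_sqrt_mult abs_of_nonneg)
  moreover have "sqrt (1 + \<rho>\<^sup>2) > 0" by (simp add: add_pos_nonneg)
  ultimately show ?thesis using eq by simp
qed

section \<open>Support functions and balls inscribed in the cones\<close>

definition support_function :: "'a::euclidean_space set \<Rightarrow> 'a \<Rightarrow> real" where
  "support_function K u = (SUP y\<in>K. u \<bullet> y)"

lemma support_function_attained:
  assumes "compact K" "K \<noteq> {}"
  shows "\<exists>y\<in>K. support_function K u = u \<bullet> y \<and> (\<forall>z\<in>K. u \<bullet> z \<le> u \<bullet> y)"
proof -
  obtain y where y: "y \<in> K" "\<And>z. z \<in> K \<Longrightarrow> u \<bullet> z \<le> u \<bullet> y"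
    using continuous_attains_sup[OF assms continuous_on_inner[OF continuous_on_const continuous_on_id], of u] by blast
  then have "support_function K u = u \<bullet> y"
    unfolding support_function_def by (intro cSup_eq_maximum) auto
  with y show ?thesis by blast
qed

lemma inner_le_support_function:
  assumes "compact K" "y \<in> K"
  shows "u \<bullet> y \<le> support_function K u"
  using support_function_attained[of K u] assms by (metis empty_iff)

lemma support_function_le:
  assumes "compact K" "K \<noteq> {}" "\<And>y. y \<in> K \<Longrightarrow> u \<bullet> y \<le> b"
  shows "support_function K u \<le> b"
  using support_function_attained[OF assms(1,2), of u] assms(3) by auto

text \<open>The vectors \<open>v\<close> tested here are normals to the circumscribed cone, so their
  angle with the axis is fixed. The axis meets \<open>K\<close> in \<open>y\<close>, and replacing
  \<open>x\<close> by \<open>y\<close> turns this angle into the term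
  \<open>\<sigma> * norm v\<close>, where \<open>\<sigma> = \<kappa> / l\<close> is the radius of
  the ball about \<open>y\<close> inscribed in the cone. Having \<open>y\<close> in \<open>K\<close>
  keeps the centres bounded in the later limit.\<close>

lemma support_function_circumscribed_right_circular:
  fixes K :: "'a::euclidean_space set"
  assumes K: "compact K" "K \<noteq> {}" and x: "x \<notin> K" and dim: "DIM('a) \<ge> 2"
    and circ: "circumscribed_right_circular K x"
  shows "\<exists>y\<in>K. \<exists>\<sigma>. \<forall>v. support_function K v = v \<bullet> x \<longrightarrow> support_function K v = v \<bullet> y + \<sigma> * norm v"
proof -
  obtain a \<rho> where a: "norm a = 1" and \<rho>: "\<rho> > 0"
    and C: "\<And>z. x + z \<in> solid_cone K x \<longleftrightarrow> norm (z - (z \<bullet> a) *\<^sub>R a) \<le> \<rho> * (z \<bullet> a)"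
    using right_circular_cone_iff_norm_le[OF circ[unfolded circumscribed_right_circular_def] dim] by metis
  have cone: "x + z \<in> solid_cone K x \<longleftrightarrow> (\<exists>l y. z = l *\<^sub>R (y - x) \<and> y \<in> K \<and> 0 \<le> l)" for z
    unfolding solid_cone_def by auto
  have "a \<bullet> a = 1" using a by (simp add: dot_square_norm)
  then have "x + a \<in> solid_cone K x" using \<rho> by (simp add: C)
  then obtain l y where l: "a = l *\<^sub>R (y - x)" "y \<in> K" "l \<ge> 0" using cone by auto
  have l0: "l > 0" using l a by (cases "l = 0") auto
  define \<kappa> where "\<kappa> = \<rho> / sqrt (1 + \<rho>\<^sup>2)"
  have "support_function K v = v \<bullet> y + (\<kappa> / l) * norm v"
    if v: "support_function K v = v \<bullet> x" for v
  proof -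
    \<comment> \<open>A contact point of \<open>K\<close> with the supporting hyperplane. It differs
      from \<open>x\<close> because \<open>x\<close> is outside \<open>K\<close>, so it provides the
      contact ray.\<close>
    obtain y0 where y0: "y0 \<in> K" "v \<bullet> y0 = v \<bullet> x"
      using support_function_attained[OF K, of v] v by auto
    have "v \<bullet> a = - \<kappa> * norm v" unfolding \<kappa>_def
    proof (rule supporting_normal_of_circular_cone[OF a \<rho>])
      fix z assume "norm (z - (z \<bullet> a) *\<^sub>R a) \<le> \<rho> * (z \<bullet> a)"
      then obtain k y' where k: "z = k *\<^sub>R (y' - x)" "y' \<in> K" "0 \<le> k" using C cone by blast
      have "v \<bullet> (y' - x) \<le> 0"
        using inner_le_support_function[OF K(1) k(2), of v] v by (simp add: inner_diff_right)
      then show "v \<bullet> z \<le> 0" using k by (simp add: mult_nonneg_nonpos)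
    next
      show "y0 - x \<noteq> 0" using y0 x by auto
      show "v \<bullet> (y0 - x) = 0" using y0 by (simp add: inner_diff_right)
      have "x + (y0 - x) \<in> solid_cone K x" unfolding cone using y0 by (intro exI[of _ 1]) auto
      then show "norm (y0 - x - ((y0 - x) \<bullet> a) *\<^sub>R a) \<le> \<rho> * ((y0 - x) \<bullet> a)" by (simp only: C)
    qed
    moreover have "v \<bullet> a = l * (v \<bullet> y - v \<bullet> x)" by (simp add: l inner_diff_right)
    ultimately show ?thesis using l0 v by (simp add: field_simps)
  qed
  with l show ?thesis by blast
qed

lemma support_function_add_le:
  assumes "compact K" "K \<noteq> {}"
  shows "support_function K (u + v) \<le> support_function K u + support_function K v"
  using assms inner_le_support_function
  by (intro support_function_le) (auto simp: inner_add_left intro!: add_mono)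

lemma support_function_scaleR:
  assumes K: "compact K" "K \<noteq> {}" and a: "a \<ge> 0"
  shows "support_function K (a *\<^sub>R u) = a * support_function K u"
proof (rule antisym)
  show "support_function K (a *\<^sub>R u) \<le> a * support_function K u"
    using K a inner_le_support_function by (intro support_function_le) (auto intro!: mult_left_mono)
  obtain y where "y \<in> K" "support_function K u = u \<bullet> y"
    using support_function_attained[OF K] by blast
  then show "a * support_function K u \<le> support_function K (a *\<^sub>R u)"
    using inner_le_support_function[OF K(1), of y "a *\<^sub>R u"] by simp
qed

lemma support_function_lipschitz:
  assumes K: "compact K" "K \<noteq> {}" and M: "\<And>y. y \<in> K \<Longrightarrow> norm y \<le> M"
  shows "\<bar>support_function K u - support_function K v\<bar> \<le> M * norm (u - v)"
proof -
  have "support_function K u \<le> support_function K v + M * norm (u - v)" for u v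
  proof (rule support_function_le[OF K])
    fix y assume y: "y \<in> K"
    have "(u - v) \<bullet> y \<le> norm (u - v) * norm y" by (rule norm_cauchy_schwarz)
    also have "\<dots> \<le> M * norm (u - v)" using M[OF y] by (simp add: mult.commute mult_right_mono)
    finally show "u \<bullet> y \<le> support_function K v + M * norm (u - v)"
      using inner_le_support_function[OF K(1) y, of v] by (simp add: inner_diff_left)
  qed
  from this[of u v] this[of v u] show ?thesis by (simp add: norm_minus_commute abs_le_iff)
qed

lemma mem_iff_support_function:
  assumes "compact K" "convex K" "K \<noteq> {}"
  shows "y \<in> K \<longleftrightarrow> (\<forall>u. u \<bullet> y \<le> support_function K u)"
proof
  assume *: "\<forall>u. u \<bullet> y \<le> support_function K u"
  show "y \<in> K"
  proof (rule ccontr)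
    assume "y \<notin> K"
    then obtain a b where ab: "a \<bullet> y < b" "\<And>x. x \<in> K \<Longrightarrow> b < a \<bullet> x"
      using separating_hyperplane_closed_point[OF assms(2) compact_imp_closed[OF assms(1)]] by blast
    have "support_function K (- a) \<le> - b"
      using assms ab by (intro support_function_le) (auto simp: less_imp_le)
    with *[rule_format, of "- a"] ab show False by simp
  qed
qed (use assms inner_le_support_function in blast)

section \<open>Tangent normals for apices going to infinity\<close>

lemma support_function_eq_near_normal:
  fixes K :: "'a::euclidean_space set"
  assumes K: "compact K" "K \<noteq> {}" and M: "\<And>y. y \<in> K \<Longrightarrow> norm y \<le> M"
    and w: "norm w = 1" and u: "u \<bullet> w = 0" and \<epsilon>: "\<epsilon> > 0"
    and t: "t * \<epsilon> \<ge> (M + norm x) * (norm u + \<epsilon>)"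
  obtains s where "\<bar>s\<bar> \<le> \<epsilon>"
    "support_function K (u + s *\<^sub>R w) = (u + s *\<^sub>R w) \<bullet> (x - t *\<^sub>R w)"
proof -
  let ?h = "support_function K"
  \<comment> \<open>A zero of \<open>f\<close> gives a tangent normal of the cone with apex
    \<open>x - t *\<^sub>R w\<close>. Shifting the apex along \<open>w\<close> contributes
    \<open>t * s\<close>, which by the assumption on \<open>t\<close> outweighs or balances the rest
    at \<open>s = \<epsilon>\<close> and \<open>s = - \<epsilon>\<close>; the intermediate value
    theorem applies.\<close>
  define f where "f s = ?h (u + s *\<^sub>R w) - (u + s *\<^sub>R w) \<bullet> (x - t *\<^sub>R w)" for s
  have ww: "w \<bullet> w = 1" using w by (simp add: dot_square_norm)
  have M0: "M \<ge> 0" using K(2) M norm_ge_zero order_trans by blast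
  have f_eq: "f s = ?h (u + s *\<^sub>R w) - (u + s *\<^sub>R w) \<bullet> x + t * s" for s
    using u ww by (simp add: f_def inner_diff_right inner_add_left algebra_simps)
  have bound: "\<bar>?h (u + s *\<^sub>R w) - (u + s *\<^sub>R w) \<bullet> x\<bar> \<le> (M + norm x) * (norm u + \<epsilon>)"
    if "\<bar>s\<bar> \<le> \<epsilon>" for s
  proof -
    let ?v = "u + s *\<^sub>R w"
    have h0: "?h 0 = 0" using support_function_scaleR[OF K, of 0 0] by simp
    have "\<bar>?h ?v\<bar> \<le> M * norm ?v"
      using support_function_lipschitz[OF K M, of ?v 0] h0 by simp
    moreover have "\<bar>?v \<bullet> x\<bar> \<le> norm x * norm ?v" using Cauchy_Schwarz_ineq2[of ?v x] by (simp add: mult.commute)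
    ultimately have "\<bar>?h ?v - ?v \<bullet> x\<bar> \<le> (M + norm x) * norm ?v" by (simp add: distrib_right)
    also have "norm ?v \<le> norm u + \<epsilon>" using norm_triangle_ineq[of u "s *\<^sub>R w"] w that by simp
    finally show ?thesis using M0 by (simp add: mult_left_mono)
  qed
  have "continuous_on UNIV ?h"
    using support_function_lipschitz[OF K M] M0
    by (intro lipschitz_on_continuous_on[of M] lipschitz_onI) (auto simp: dist_norm)
  then have "continuous_on {-\<epsilon>..\<epsilon>} (\<lambda>s. ?h (u + s *\<^sub>R w))"
    by (rule continuous_on_compose2) (auto intro!: continuous_intros)
  then have "continuous_on {-\<epsilon>..\<epsilon>} f" unfolding f_def by (intro continuous_intros)
  moreover have "f (-\<epsilon>) \<le> 0" "0 \<le> f \<epsilon>"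
    using bound[of \<epsilon>] bound[of "-\<epsilon>"] t \<epsilon> by (simp_all add: f_eq abs_le_iff)
  ultimately obtain s where "-\<epsilon> \<le> s" "s \<le> \<epsilon>" "f s = 0" using IVT'[of f "-\<epsilon>" 0 \<epsilon>] \<epsilon> by auto
  then show thesis using that[of s] by (simp add: f_def abs_le_iff)
qed

text \<open>From far apices \<open>x - real n *\<^sub>R w\<close> there are tangent normals
  arbitrarily close to any \<open>u\<close> orthogonal to \<open>w\<close>. For large
  \<open>n\<close> the centres \<open>Y n\<close> lie in \<open>K\<close> and the
  \<open>\<sigma> n\<close> are bounded, so the exact formula at the nearby normal holds at
  \<open>u\<close> up to a vanishing error. Convergence of \<open>Y\<close> or
  \<open>\<sigma>\<close> alone is not claimed.\<close>

lemma support_function_limit_of_tangent_balls: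
  fixes K :: "'a::euclidean_space set"
  assumes K: "compact K" "K \<noteq> {}" and w: "norm w = 1"
    and tangent: "\<And>t. x - t *\<^sub>R w \<notin> K \<Longrightarrow> \<exists>y\<in>K. \<exists>\<sigma>. \<forall>v.
      support_function K v = v \<bullet> (x - t *\<^sub>R w) \<longrightarrow> support_function K v = v \<bullet> y + \<sigma> * norm v"
  obtains Y \<sigma> where
    "\<And>u. u \<bullet> w = 0 \<Longrightarrow> (\<lambda>n. u \<bullet> Y n + \<sigma> n * norm u) \<longlonglongrightarrow> support_function K u"
proof -
  let ?h = "support_function K"
  obtain M where M: "\<And>y. y \<in> K \<Longrightarrow> norm y \<le> M"
    using compact_imp_bounded[OF K(1)] bounded_iff by metis
  then have M0: "M \<ge> 0" using K(2) norm_ge_zero order_trans by blast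
  obtain N :: nat where N: "M + norm x < N" using reals_Archimedean2 by blast
  have out: "x - real n *\<^sub>R w \<notin> K" if "n \<ge> N" for n
  proof
    assume "x - real n *\<^sub>R w \<in> K"
    then have "norm (x - real n *\<^sub>R w) \<le> M" by (rule M)
    moreover have "real n \<le> norm x + norm (x - real n *\<^sub>R w)"
      using norm_triangle_ineq4[of x "x - real n *\<^sub>R w"] w by simp
    ultimately show False using N that by linarith
  qed
  then have "\<forall>n. \<exists>y \<sigma>. n \<ge> N \<longrightarrow> y \<in> K \<and> (\<forall>v. ?h v = v \<bullet> (x - real n *\<^sub>R w) \<longrightarrow> ?h v = v \<bullet> y + \<sigma> * norm v)"
    using tangent by blast
  then obtain Y \<sigma> where Y: "\<And>n. n \<ge> N \<Longrightarrow> Y n \<in> K"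
    and \<sigma>: "\<And>n v. n \<ge> N \<Longrightarrow> ?h v = v \<bullet> (x - real n *\<^sub>R w) \<Longrightarrow> ?h v = v \<bullet> Y n + \<sigma> n * norm v"
    by metis
  have h0: "?h 0 = 0" using support_function_scaleR[OF K, of 0 0] by simp
  have "(\<lambda>n. u \<bullet> Y n + \<sigma> n * norm u) \<longlonglongrightarrow> ?h u" if u: "u \<bullet> w = 0" for u
  proof (cases "u = 0")
    case True
    then show ?thesis using h0 by simp
  next
    case False
    show ?thesis
    proof (rule LIMSEQ_I)
      fix \<delta> :: real assume \<delta>: "\<delta> > 0"
      \<comment> \<open>\<open>Y n\<close>, \<open>\<sigma> n\<close> and \<open>?h\<close> will
        cause errors of at most \<open>M * \<epsilon>\<close>, \<open>2 * M * \<epsilon>\<close> and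
        \<open>M * \<epsilon>\<close>. The \<open>+ 1\<close> keeps their sum strictly below
        \<open>\<delta>\<close> and covers \<open>M = 0\<close>.\<close>
      define \<epsilon> where "\<epsilon> = \<delta> / (4 * M + 1)"
      have \<epsilon>: "\<epsilon> > 0" using \<delta> M0 by (simp add: \<epsilon>_def)
      obtain n0 :: nat where n0: "(M + norm x) * (norm u + \<epsilon>) / \<epsilon> < n0" using reals_Archimedean2 by blast
      show "\<exists>no. \<forall>n\<ge>no. norm (u \<bullet> Y n + \<sigma> n * norm u - ?h u) < \<delta>"
      proof (intro exI allI impI)
        fix n assume n: "n \<ge> max N n0"
        have "(M + norm x) * (norm u + \<epsilon>) / \<epsilon> \<le> n" using n n0 by linarith
        then have "real n * \<epsilon> \<ge> (M + norm x) * (norm u + \<epsilon>)" using \<epsilon> by (simp add: divide_le_eq)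
        then obtain s where s: "\<bar>s\<bar> \<le> \<epsilon>" "?h (u + s *\<^sub>R w) = (u + s *\<^sub>R w) \<bullet> (x - real n *\<^sub>R w)"
          using support_function_eq_near_normal[OF K M w u \<epsilon>] by metis
        define v where "v = u + s *\<^sub>R w"
        have hv: "?h v = v \<bullet> Y n + \<sigma> n * norm v" using \<sigma>[OF _ s(2)] n by (simp add: v_def)
        \<comment> \<open>This permits division by \<open>norm v\<close> when
          \<open>\<sigma> n\<close> is bounded. The component of \<open>v\<close> orthogonal to
          \<open>w\<close> is the nonzero \<open>u\<close>.\<close>
        have v0: "v \<noteq> 0"
        proof
          assume "v = 0"
          then have "v \<bullet> w = 0" by simp
          then have "s = 0" using u w by (simp add: v_def inner_add_left dot_square_norm)
          with \<open>v = 0\<close> False show False by (simp add: v_def)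
        qed
        have YM: "norm (Y n) \<le> M" using n Y M by auto
        have ip: "\<bar>z \<bullet> Y n\<bar> \<le> M * norm z" for z
          using Cauchy_Schwarz_ineq2[of z "Y n"] mult_left_mono[OF YM norm_ge_zero[of z]]
          by (simp add: mult.commute)
        have "\<bar>\<sigma> n * norm v\<bar> \<le> 2 * M * norm v"
          using hv support_function_lipschitz[OF K M, of v 0] h0 ip[of v] by (simp add: abs_le_iff)
        then have \<sigma>M: "\<bar>\<sigma> n\<bar> \<le> 2 * M" using v0 by (simp add: abs_mult)
        have uv: "norm (u - v) \<le> \<epsilon>" using s w by (simp add: v_def)
        have "\<bar>norm u - norm v\<bar> \<le> \<epsilon>" using norm_triangle_ineq3[of u v] uv by linarith
        then have 1: "\<bar>\<sigma> n * (norm u - norm v)\<bar> \<le> 2 * M * \<epsilon>"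
          using \<sigma>M M0 by (simp add: abs_mult mult_mono)
        have 2: "\<bar>(u - v) \<bullet> Y n\<bar> \<le> M * \<epsilon>"
          using ip[of "u - v"] mult_left_mono[OF uv M0] by linarith
        have 3: "\<bar>?h u - ?h v\<bar> \<le> M * \<epsilon>"
          using support_function_lipschitz[OF K M, of u v] mult_left_mono[OF uv M0] by linarith
        have "u \<bullet> Y n + \<sigma> n * norm u - ?h u = (u - v) \<bullet> Y n + \<sigma> n * (norm u - norm v) - (?h u - ?h v)"
          using hv by (simp add: inner_diff_left algebra_simps)
        then have "norm (u \<bullet> Y n + \<sigma> n * norm u - ?h u) \<le> 4 * M * \<epsilon>" using 1 2 3 by simp
        also have "\<dots> < \<delta>" using \<delta> M0 by (simp add: \<epsilon>_def field_simps)
        finally show "norm (u \<bullet> Y n + \<sigma> n * norm u - ?h u) < \<delta>" .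
      qed
    qed
  qed
  with that show thesis by blast
qed

text \<open>Adding the approximations at \<open>u\<close> and \<open>- u\<close> leaves a term that
  depends only on \<open>norm u\<close>; subtracting leaves one linear in \<open>u\<close>. Both
  properties pass to the limit by uniqueness of limits.\<close>

lemma support_function_limit_symmetrization:
  fixes h :: "'a::euclidean_space \<Rightarrow> real"
  assumes lim: "\<And>u. u \<bullet> w = 0 \<Longrightarrow> (\<lambda>n. u \<bullet> Y n + \<sigma> n * norm u) \<longlonglongrightarrow> h u"
  shows "u \<bullet> w = 0 \<Longrightarrow> v \<bullet> w = 0 \<Longrightarrow> norm u = norm v \<Longrightarrow> h u + h (- u) = h v + h (- v)"
    and "u \<bullet> w = 0 \<Longrightarrow> v \<bullet> w = 0 \<Longrightarrow> h (u + v) - h (- (u + v)) = (h u - h (- u)) + (h v - h (- v))"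
proof -
  have even: "(\<lambda>n. 2 * \<sigma> n * norm u) \<longlonglongrightarrow> h u + h (- u)"
    and odd: "(\<lambda>n. 2 * (u \<bullet> Y n)) \<longlonglongrightarrow> h u - h (- u)" if "u \<bullet> w = 0" for u
    using tendsto_add[OF lim[of u] lim[of "- u"]] tendsto_diff[OF lim[of u] lim[of "- u"]] that
    by (simp_all add: algebra_simps)
  {
    assume "u \<bullet> w = 0" "v \<bullet> w = 0" "norm u = norm v"
    then show "h u + h (- u) = h v + h (- v)" using even[of u] even[of v] LIMSEQ_unique by auto
  next
    assume uv: "u \<bullet> w = 0" "v \<bullet> w = 0"
    then have "(\<lambda>n. 2 * ((u + v) \<bullet> Y n)) \<longlonglongrightarrow> (h u - h (- u)) + (h v - h (- v))"
      using tendsto_add[OF odd[of u] odd[of v]] by (simp add: inner_add_left)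
    moreover have "(\<lambda>n. 2 * ((u + v) \<bullet> Y n)) \<longlonglongrightarrow> h (u + v) - h (- (u + v))"
      using uv by (intro odd) (simp add: inner_add_left)
    ultimately show "h (u + v) - h (- (u + v)) = (h u - h (- u)) + (h v - h (- v))"
      using LIMSEQ_unique by blast
  }
qed

section \<open>Linearity of the odd part and recognition of the ball\<close>

lemma norm_add_scaleR_asymptotic:
  fixes e :: "'a::real_inner"
  assumes "norm e = 1"
  shows "((\<lambda>s. norm (p + s *\<^sub>R e) - s) \<longlongrightarrow> p \<bullet> e) at_top"
proof -
  have "norm (p + s *\<^sub>R e) = sqrt (s\<^sup>2 + 2 * s * (p \<bullet> e) + (norm p)\<^sup>2)" for s
    using assms unfolding norm_eq_sqrt_inner
    by (simp add: inner_add_left inner_add_right inner_commute power2_eq_square algebra_simps)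
  moreover have "((\<lambda>s. sqrt (s\<^sup>2 + 2 * s * b + c) - s) \<longlongrightarrow> b) at_top" for b c :: real
    by real_asymp
  ultimately show ?thesis by simp
qed

text \<open>Additivity of the odd part \<open>G\<close> is given only when one summand is a multiple
  of \<open>e\<close>. Subadditivity of \<open>h\<close>, used far out along \<open>e\<close> where
  the norm is nearly additive, extends it to all pairs.\<close>

lemma subadditive_symmetrization_linear:
  fixes h :: "'a::euclidean_space \<Rightarrow> real"
  assumes sub: "\<And>u v. h (u + v) \<le> h u + h v"
    and hom: "\<And>a u. a \<ge> 0 \<Longrightarrow> h (a *\<^sub>R u) = a * h u"
    and e: "norm e = 1"
    and width: "\<And>u. h u + h (- u) = 2 * r * norm u"
    and add: "\<And>u s. h (u + s *\<^sub>R e) - h (- (u + s *\<^sub>R e)) = (h u - h (- u)) + (h (s *\<^sub>R e) - h (- (s *\<^sub>R e)))"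
  shows "\<exists>c. \<forall>u. h u = c \<bullet> u + r * norm u"
proof -
  define G where "G u = (h u - h (- u)) / 2" for u
  have h: "h u = G u + r * norm u" for u using width[of u] by (simp add: G_def field_simps)
  have odd: "G (- u) = - G u" for u by (simp add: G_def field_simps)
  have Gpos: "G (a *\<^sub>R u) = a * G u" if "a \<ge> 0" for a u
    using hom[OF that, of u] hom[OF that, of "- u"] by (simp add: G_def right_diff_distrib)
  have Ghom: "G (a *\<^sub>R u) = a * G u" for a u
  proof (cases "a \<ge> 0")
    case False
    then have "G ((- a) *\<^sub>R (- u)) = - a * G (- u)" by (intro Gpos) auto
    then show ?thesis using odd by simp
  qed (rule Gpos)
  have Ge: "G (u + s *\<^sub>R e) = G u + s * G e" for u s
    using add[of u s] Ghom[of s e] by (simp add: G_def field_simps)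
  have Gsub: "G (p + q) \<le> G p + G q" for p q
  proof -
    \<comment> \<open>In the subadditivity of \<open>h\<close> at \<open>p + s *\<^sub>R e\<close>
      and \<open>q + s *\<^sub>R e\<close> the multiples of \<open>G e\<close> cancel. The inserted
      \<open>s\<close>, \<open>s\<close> and \<open>2 * s\<close> cancel too and give each norm a
      finite limit; the limit of the whole bound is 0.\<close>
    have "G (p + q) - (G p + G q) \<le>
        r * ((norm (p + s *\<^sub>R e) - s) + (norm (q + s *\<^sub>R e) - s) - (norm (p + q + (2 * s) *\<^sub>R e) - 2 * s))" for s
    proof -
      have "(p + s *\<^sub>R e) + (q + s *\<^sub>R e) = p + q + (2 * s) *\<^sub>R e"
        by (simp add: algebra_simps flip: scaleR_2)
      then have "h (p + q + (2 * s) *\<^sub>R e) \<le> h (p + s *\<^sub>R e) + h (q + s *\<^sub>R e)" using sub by metis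
      then show ?thesis unfolding h Ge by (simp add: algebra_simps)
    qed
    moreover have "((\<lambda>s. r * ((norm (p + s *\<^sub>R e) - s) + (norm (q + s *\<^sub>R e) - s) - (norm (p + q + (2 * s) *\<^sub>R e) - 2 * s)))
        \<longlongrightarrow> r * (p \<bullet> e + q \<bullet> e - (p + q) \<bullet> e)) at_top"
    proof -
      have "filterlim (\<lambda>s::real. 2 * s) at_top at_top" by real_asymp
      from filterlim_compose[OF norm_add_scaleR_asymptotic[OF e, of "p + q"] this]
      show ?thesis by (intro tendsto_intros norm_add_scaleR_asymptotic e)
    qed
    ultimately have "G (p + q) - (G p + G q) \<le> r * (p \<bullet> e + q \<bullet> e - (p + q) \<bullet> e)"
      by (intro tendsto_lowerbound) auto
    then show ?thesis by (simp add: inner_add_left)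
  qed
  \<comment> \<open>The inequality at \<open>- p\<close> and \<open>- q\<close> is the reverse one,
    by oddness.\<close>
  have "G (p + q) = G p + G q" for p q
    using Gsub[of p q] Gsub[of "- p" "- q"] odd[of "p + q"] odd[of p] odd[of q] by simp
  then have "linear G" using Ghom by (intro linearI) auto
  \<comment> \<open>Riesz representation: \<open>adjoint G 1\<close> is the vector representing the
    functional \<open>G\<close>.\<close>
  then have "G u = adjoint G 1 \<bullet> u" for u
    using adjoint_works[of G u 1] by (simp add: inner_commute)
  with h show ?thesis by metis
qed

text \<open>A compact convex set is determined by its support function. Testing its half-spaces at
  \<open>u = y - c\<close> gives \<open>norm (y - c) \<le> r\<close>, and Cauchy-Schwarz gives the
  converse; the nonempty interior rules out \<open>r = 0\<close>.\<close>

lemma eq_cball_if_support_function_eq: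
  fixes K :: "'a::euclidean_space set"
  assumes "convex_body K" and h: "\<And>u. support_function K u = c \<bullet> u + r * norm u"
  shows "r > 0 \<and> K = cball c r"
proof -
  have K: "compact K" "convex K" "interior K \<noteq> {}" using assms(1) by (auto simp: convex_body_def)
  then have ne: "K \<noteq> {}" by auto
  have mem: "y \<in> K \<longleftrightarrow> (\<forall>u. u \<bullet> (y - c) \<le> r * norm u)" for y
    unfolding mem_iff_support_function[OF K(1,2) ne] h by (simp add: inner_diff_right inner_commute diff_le_eq add.commute)
  obtain y0 and b :: 'a where y0: "y0 \<in> K" and b: "b \<in> Basis" using ne nonempty_Basis by blast
  \<comment> \<open>The bounds for the opposite normals \<open>b\<close> and \<open>- b\<close> add
    up to \<open>0 \<le> 2 * r\<close>.\<close>
  have "b \<bullet> (y0 - c) \<le> r * norm b" "- b \<bullet> (y0 - c) \<le> r * norm (- b)" using y0 mem by blast+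
  then have r: "r \<ge> 0" using b by simp
  have "K = cball c r"
  proof (intro set_eqI iffI)
    fix y assume "y \<in> K"
    then have "(y - c) \<bullet> (y - c) \<le> r * norm (y - c)" using mem by blast
    then have "norm (y - c) \<le> r"
      using r by (cases "y = c") (auto simp: dot_square_norm power2_eq_square)
    then show "y \<in> cball c r" by (simp add: dist_norm norm_minus_commute)
  next
    fix y assume "y \<in> cball c r"
    then have yc: "norm (y - c) \<le> r" by (simp add: dist_norm norm_minus_commute)
    have "u \<bullet> (y - c) \<le> r * norm u" for u
      using norm_cauchy_schwarz[of u "y - c"] mult_left_mono[OF yc norm_ge_zero[of u]] by (simp add: mult.commute)
    then show "y \<in> K" using mem by blast
  qed
  moreover have "r \<noteq> 0" using calculation K(3) by auto
  ultimately show ?thesis using r by simp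
qed

section \<open>Directions parallel to the hyperplane and the final assembly\<close>

lemma unit_vector_orthogonal_to_two:
  fixes u v :: "'a::euclidean_space"
  assumes "DIM('a) \<ge> 3"
  obtains w where "norm w = 1" "u \<bullet> w = 0" "v \<bullet> w = 0"
proof -
  have "dim {u, v} \<le> card {u, v}" by (rule dim_le_card') simp
  also have "\<dots> \<le> 2" by (simp add: card_insert_if)
  finally have "dim {u, v} < DIM('a)" using assms by simp
  then obtain w where w: "w \<noteq> 0" "span {u, v} \<subseteq> {x. w \<bullet> x = 0}"
    using lowdim_subset_hyperplane by blast
  have "w \<bullet> u = 0" "w \<bullet> v = 0" using w(2) span_base[of _ "{u, v}"] by blast+
  with w(1) that[of "sgn w"] show thesis by (simp add: norm_sgn sgn_div_norm inner_commute)
qed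

lemma hyperplane_unit_normal:
  fixes P :: "'a::euclidean_space set"
  assumes "hyperplane P"
  obtains e b where "norm e = 1" "P = {x. e \<bullet> x = b}"
proof -
  obtain a b where a: "a \<noteq> 0" "P = {x. a \<bullet> x = b}"
    using assms aff_dim_eq_hyperplane[of P] by (metis affine_hull_eq hyperplane_def of_nat_1 of_nat_diff DIM_ge_Suc0 One_nat_def)
  have "P = {x. sgn a \<bullet> x = b / norm a}" using a by (auto simp: sgn_div_norm field_simps)
  moreover have "norm (sgn a) = 1" using a by (simp add: norm_sgn)
  ultimately show thesis using that by blast
qed

theorem circumscribed_right_circular_imp_cball:
  fixes K P :: "'a::euclidean_space set"
  assumes dim: "DIM('a) \<ge> 3" and body: "convex_body K" and "hyperplane P"
    and circ: "\<forall>x \<in> P - K. circumscribed_right_circular K x"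
  shows "\<exists>c r. r > 0 \<and> K = cball c r"
proof -
  have K: "compact K" "K \<noteq> {}" using body by (auto simp: convex_body_def)
  obtain e b where e: "norm e = 1" and P: "P = {x. e \<bullet> x = b}"
    using hyperplane_unit_normal[OF \<open>hyperplane P\<close>] by metis
  let ?h = "support_function K"
  define x0 where "x0 = b *\<^sub>R e"
  have x0: "x0 \<in> P" using e by (simp add: x0_def P dot_square_norm)
  \<comment> \<open>As \<open>w\<close> is orthogonal to \<open>e\<close>, all apices
    \<open>x0 - t *\<^sub>R w\<close> stay in \<open>P\<close>, where the cones are right
    circular.\<close>
  have lim: "\<exists>Y \<sigma>. \<forall>u. u \<bullet> w = 0 \<longrightarrow> (\<lambda>n. u \<bullet> Y n + \<sigma> n * norm u) \<longlonglongrightarrow> ?h u"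
    if w: "norm w = 1" "e \<bullet> w = 0" for w
  proof (rule support_function_limit_of_tangent_balls[OF K w(1)])
    fix t assume "x0 - t *\<^sub>R w \<notin> K"
    moreover have "x0 - t *\<^sub>R w \<in> P" using x0 w by (simp add: P inner_diff_right)
    ultimately show "\<exists>y\<in>K. \<exists>\<sigma>. \<forall>v. ?h v = v \<bullet> (x0 - t *\<^sub>R w) \<longrightarrow> ?h v = v \<bullet> y + \<sigma> * norm v"
      using dim circ by (intro support_function_circumscribed_right_circular[OF K]) auto
  qed blast
  define r where "r = (?h e + ?h (- e)) / 2"
  have "\<exists>c. \<forall>u. ?h u = c \<bullet> u + r * norm u"
  proof (rule subadditive_symmetrization_linear[OF _ _ e])
    fix u :: 'a and s :: real
    \<comment> \<open>Dimension at least three puts \<open>u\<close> and \<open>e\<close> into the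
      orthogonal complement of one \<open>w\<close>. There the width at \<open>u\<close> equals that
      at \<open>norm u *\<^sub>R e\<close>, and the odd part is additive on \<open>u\<close> and
      \<open>s *\<^sub>R e\<close>.\<close>
    obtain w where w: "norm w = 1" "e \<bullet> w = 0" "u \<bullet> w = 0"
      using unit_vector_orthogonal_to_two[OF dim] by metis
    obtain Y \<sigma> where *: "\<And>u. u \<bullet> w = 0 \<Longrightarrow> (\<lambda>n. u \<bullet> Y n + \<sigma> n * norm u) \<longlonglongrightarrow> ?h u"
      using lim[OF w(1,2)] by blast
    have "?h u + ?h (- u) = ?h (norm u *\<^sub>R e) + ?h (- (norm u *\<^sub>R e))"
      using w e by (intro support_function_limit_symmetrization(1)[where h = ?h, OF *]) auto
    also have "\<dots> = 2 * r * norm u"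
      using support_function_scaleR[OF K, of "norm u" e] support_function_scaleR[OF K, of "norm u" "- e"]
      by (simp add: r_def algebra_simps)
    finally show "?h u + ?h (- u) = 2 * r * norm u" .
    show "?h (u + s *\<^sub>R e) - ?h (- (u + s *\<^sub>R e)) = (?h u - ?h (- u)) + (?h (s *\<^sub>R e) - ?h (- (s *\<^sub>R e)))"
      using w by (intro support_function_limit_symmetrization(2)[where h = ?h, OF *]) auto
  qed (intro support_function_add_le support_function_scaleR K; assumption)+
  then show ?thesis using eq_cball_if_support_function_eq[OF body] by metis
qed

theorem theorem3:
  fixes K P :: "(real ^ 'n) set"
  assumes "CARD('n) \<ge> 3"
    and "convex_body K"
    and "hyperplane P"
    and "\<forall>x \<in> P - K. circumscribed_right_circular K x"
  shows "\<exists>c r. r > 0 \<and> K = cball c r"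
  using assms by (intro circumscribed_right_circular_imp_cball) auto

end
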